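(* Let $\mathcal{V}$ be a monoidal category and let $\mathcal{S}$ be a tensor-closed $\mathcal{V}$-module, with functor $\underline{\mathcal{S}}(-,-):\mathcal{S}^{\mathrm{op}}\times\mathcal{S}\to\mathcal{V}$, natural bijections $\phi_{K,X,Y}:\mathcal{S}(K\otimes X,Y)\to\mathcal{V}(K,\underline{\mathcal{S}}(X,Y))$ and counits $\epsilon_Y:\underline{\mathcal{S}}(X,Y)\otimes X\to Y$. For $X,Y,Z\in\operatorname{ob}\mathcal{S}$ let $$\underline{\bullet}_{X,Y,Z}=\phi_{\underline{\mathcal{S}}(Y,Z)\otimes\underline{\mathcal{S}}(X,Y),X,Z}\bigl(\epsilon_Z\cdot(1\otimes\epsilon_Y)\cdot a\bigr):\underline{\mathcal{S}}(Y,Z)\otimes\underline{\mathcal{S}}(X,Y)\to\underline{\mathcal{S}}(X,Z),$$ and let $\varphi$ be the natural isomorphism with components $\varphi_{X,Y}:\mathcal{S}(X,Y)\to\mathcal{V}(I,\underline{\mathcal{S}}(X,Y))$, $\varphi_{X,Y}(f)=\phi_{I,X,Y}(f\cdot l_X)$. Then $\underline{\mathcal{S}}(-,-)$, $\underline{\bullet}_{X,Y,Z}$ and $\varphi$ form a $\mathcal{V}$-structure on $\mathcal{S}$.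
   Context: Composition of morphisms is written $g\cdot f$. A monoidal category $\mathcal{V}=(\mathcal{V},\otimes,I,a,l,r)$ has structure isomorphisms $a_{X,Y,Z}:(X\otimes Y)\otimes Z\to X\otimes(Y\otimes Z)$, $l_X:I\otimes X\to X$, $r_X:X\otimes I\to X$. Here $\mathcal{V}$ is not assumed closed or symmetric. A (left) $\mathcal{V}$-module is a category $\mathcal{S}$ with a functor $-\otimes-:\mathcal{V}\times\mathcal{S}\to\mathcal{S}$ and isomorphisms $a_{K,L,X}:(K\otimes L)\otimes X\to K\otimes(L\otimes X)$ natural in $K,L\in\mathcal{V}$, $X\in\mathcal{S}$, and $l_X:I\otimes X\to X$ natural in $X$, satisfying the pentagon $a_{K,L,M\otimes X}\cdot a_{K\otimes L,M,X}=(1\otimes a_{L,M,X})\cdot a_{K,L\otimes M,X}\cdot(a_{K,L,M}\otimes1)$ and the triangle $(1\otimes l_X)\cdot a_{K,I,X}=r_K\otimes1$. It is tensor-closed if it is equipped with a functor $\underline{\mathcal{S}}(-,-):\mathcal{S}^{\mathrm{op}}\times\mathcal{S}\to\mathcal{V}$ and bijections $\phi_{K,X,Y}:\mathcal{S}(K\otimes X,Y)\to\mathcal{V}(K,\underline{\mathcal{S}}(X,Y))$ natural in $K,X,Y$; $\epsilon_Y:\underline{\mathcal{S}}(X,Y)\otimes X\to Y$ is the counit of the adjunction $\phi_{-,X,-}$. A $\mathcal{V}$-structure on a category $\mathcal{S}$ consists of: a functor $\underline{\mathcal{S}}(-,-):\mathcal{S}^{\mathrm{op}}\times\mathcal{S}\to\mathcal{V}$;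 for all $X,Y,Z$ a morphism $\underline{\bullet}_{X,Y,Z}:\underline{\mathcal{S}}(Y,Z)\otimes\underline{\mathcal{S}}(X,Y)\to\underline{\mathcal{S}}(X,Z)$ of $\mathcal{V}$; and a natural isomorphism $\varphi:\mathcal{S}(-,-)\to\mathcal{V}(I,\underline{\mathcal{S}}(-,-))$; such that (i) $\underline{\bullet}\cdot(\underline{\bullet}\otimes1)=\underline{\bullet}\cdot(1\otimes\underline{\bullet})\cdot a$ as morphisms $(\underline{\mathcal{S}}(Z,W)\otimes\underline{\mathcal{S}}(Y,Z))\otimes\underline{\mathcal{S}}(X,Y)\to\underline{\mathcal{S}}(X,W)$; (ii) for $f\in\mathcal{S}(X,Y)$, $\underline{\mathcal{S}}(f,Z)=\underline{\bullet}\cdot(1\otimes\varphi(f))\cdot r^{-1}:\underline{\mathcal{S}}(Y,Z)\to\underline{\mathcal{S}}(X,Z)$; (iii) for $g\in\mathcal{S}(Y,Z)$, $\underline{\mathcal{S}}(X,g)=\underline{\bullet}\cdot(\varphi(g)\otimes1)\cdot l^{-1}:\underline{\mathcal{S}}(X,Y)\to\underline{\mathcal{S}}(X,Z)$. *)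

theory Defs
  imports Main
begin

text \<open>The domain and codomain are recorded in the morphism, so hom-sets are pairwise disjoint;
  \<open>g \<cdot>\<^bsub>C\<^esub> f\<close> is only meaningful if the codomain of \<open>f\<close> is the domain of \<open>g\<close>.\<close>

record ('o, 'm) cat =
  Ob :: "'o set"
  Mor :: "'m set"
  Dom :: "'m \<Rightarrow> 'o"
  Cod :: "'m \<Rightarrow> 'o"
  Id :: "'o \<Rightarrow> 'm" ("\<one>\<index>")
  Comp :: "'m \<Rightarrow> 'm \<Rightarrow> 'm" (infixr "\<cdot>\<index>" 65)

definition hom :: "('o, 'm, 'z) cat_scheme \<Rightarrow> 'o \<Rightarrow> 'o \<Rightarrow> 'm set" where
  "hom C X Y = {f \<in> Mor C. Dom C f = X \<and> Cod C f = Y}"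

locale category =
  fixes C :: "('o, 'm, 'z) cat_scheme" (structure)
  assumes Dom_in_Ob: "f \<in> Mor C \<Longrightarrow> Dom C f \<in> Ob C"
    and Cod_in_Ob: "f \<in> Mor C \<Longrightarrow> Cod C f \<in> Ob C"
    and Id_in_hom: "X \<in> Ob C \<Longrightarrow> \<one> X \<in> hom C X X"
    and Comp_in_hom: "\<lbrakk>f \<in> hom C X Y; g \<in> hom C Y Z\<rbrakk> \<Longrightarrow> g \<cdot> f \<in> hom C X Z"
    and Comp_assoc: "\<lbrakk>f \<in> hom C X Y; g \<in> hom C Y Z; h \<in> hom C Z W\<rbrakk>
      \<Longrightarrow> (h \<cdot> g) \<cdot> f = h \<cdot> (g \<cdot> f)"
    and Id_left: "f \<in> hom C X Y \<Longrightarrow> \<one> Y \<cdot> f = f"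
    and Id_right: "f \<in> hom C X Y \<Longrightarrow> f \<cdot> \<one> X = f"

definition inverse_pair :: "('o, 'm, 'z) cat_scheme \<Rightarrow> 'm \<Rightarrow> 'm \<Rightarrow> bool" where
  "inverse_pair C f g \<longleftrightarrow> f \<in> Mor C \<and> g \<in> hom C (Cod C f) (Dom C f) \<and>
     g \<cdot>\<^bsub>C\<^esub> f = \<one>\<^bsub>C\<^esub> (Dom C f) \<and> f \<cdot>\<^bsub>C\<^esub> g = \<one>\<^bsub>C\<^esub> (Cod C f)"

definition iso_hom :: "('o, 'm, 'z) cat_scheme \<Rightarrow> 'o \<Rightarrow> 'o \<Rightarrow> 'm set" where
  "iso_hom C X Y = {f \<in> hom C X Y. \<exists>g. inverse_pair C f g}"

definition inverse_mor :: "('o, 'm, 'z) cat_scheme \<Rightarrow> 'm \<Rightarrow> 'm" where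
  "inverse_mor C f = (THE g. inverse_pair C f g)"

definition opposite_cat :: "('o, 'm, 'z) cat_scheme \<Rightarrow> ('o, 'm) cat" where
  "opposite_cat C = \<lparr>Ob = Ob C, Mor = Mor C, Dom = Cod C, Cod = Dom C, Id = Id C,
     Comp = (\<lambda>g f. f \<cdot>\<^bsub>C\<^esub> g)\<rparr>"

definition product_cat ::
  "('o, 'm, 'y) cat_scheme \<Rightarrow> ('p, 'n, 'z) cat_scheme \<Rightarrow> ('o \<times> 'p, 'm \<times> 'n) cat" where
  "product_cat A B = \<lparr>Ob = Ob A \<times> Ob B, Mor = Mor A \<times> Mor B,
     Dom = map_prod (Dom A) (Dom B), Cod = map_prod (Cod A) (Cod B),
     Id = map_prod (Id A) (Id B),
     Comp = (\<lambda>(g, g') (f, f'). (g \<cdot>\<^bsub>A\<^esub> f, g' \<cdot>\<^bsub>B\<^esub> f'))\<rparr>"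

locale cat_functor =
  A: category A + B: category B
  for A :: "('o, 'm, 'y) cat_scheme" and B :: "('p, 'n, 'z) cat_scheme" +
  fixes F\<^sub>o :: "'o \<Rightarrow> 'p" and F\<^sub>m :: "'m \<Rightarrow> 'n"
  assumes ob_in_Ob: "X \<in> Ob A \<Longrightarrow> F\<^sub>o X \<in> Ob B"
    and mor_in_hom: "f \<in> hom A X Y \<Longrightarrow> F\<^sub>m f \<in> hom B (F\<^sub>o X) (F\<^sub>o Y)"
    and preserves_Id: "X \<in> Ob A \<Longrightarrow> F\<^sub>m (\<one>\<^bsub>A\<^esub> X) = \<one>\<^bsub>B\<^esub> (F\<^sub>o X)"
    and preserves_Comp: "\<lbrakk>f \<in> hom A X Y; g \<in> hom A Y Z\<rbrakk>
      \<Longrightarrow> F\<^sub>m (g \<cdot>\<^bsub>A\<^esub> f) = F\<^sub>m g \<cdot>\<^bsub>B\<^esub> F\<^sub>m f"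

record ('o, 'm) monoidal_cat = "('o, 'm) cat" +
  tensor_ob :: "'o \<Rightarrow> 'o \<Rightarrow> 'o" (infixl "\<otimes>\<index>" 70)
  tensor_mor :: "'m \<Rightarrow> 'm \<Rightarrow> 'm" (infixl "\<otimes>\<^sub>m\<index>" 70)
  unit_ob :: 'o ("\<I>\<index>")
  assoc :: "'o \<Rightarrow> 'o \<Rightarrow> 'o \<Rightarrow> 'm"
  lunit :: "'o \<Rightarrow> 'm"
  runit :: "'o \<Rightarrow> 'm"

locale monoidal_category = category V
  for V :: "('o, 'm, 'z) monoidal_cat_scheme" (structure) +
  assumes tensor_functor:
      "cat_functor (product_cat V V) V (\<lambda>(X, Y). X \<otimes> Y) (\<lambda>(f, g). f \<otimes>\<^sub>m g)"
    and unit_in_Ob: "\<I> \<in> Ob V"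
    and assoc_iso: "\<lbrakk>X \<in> Ob V; Y \<in> Ob V; Z \<in> Ob V\<rbrakk>
      \<Longrightarrow> assoc V X Y Z \<in> iso_hom V ((X \<otimes> Y) \<otimes> Z) (X \<otimes> (Y \<otimes> Z))"
    and assoc_natural: "\<lbrakk>f \<in> hom V X X'; g \<in> hom V Y Y'; h \<in> hom V Z Z'\<rbrakk>
      \<Longrightarrow> assoc V X' Y' Z' \<cdot> ((f \<otimes>\<^sub>m g) \<otimes>\<^sub>m h) = (f \<otimes>\<^sub>m (g \<otimes>\<^sub>m h)) \<cdot> assoc V X Y Z"
    and lunit_iso: "X \<in> Ob V \<Longrightarrow> lunit V X \<in> iso_hom V (\<I> \<otimes> X) X"
    and lunit_natural: "f \<in> hom V X X' \<Longrightarrow> lunit V X' \<cdot> (\<one> \<I> \<otimes>\<^sub>m f) = f \<cdot> lunit V X"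
    and runit_iso: "X \<in> Ob V \<Longrightarrow> runit V X \<in> iso_hom V (X \<otimes> \<I>) X"
    and runit_natural: "f \<in> hom V X X' \<Longrightarrow> runit V X' \<cdot> (f \<otimes>\<^sub>m \<one> \<I>) = f \<cdot> runit V X"
    and pentagon: "\<lbrakk>X \<in> Ob V; Y \<in> Ob V; Z \<in> Ob V; W \<in> Ob V\<rbrakk>
      \<Longrightarrow> assoc V X Y (Z \<otimes> W) \<cdot> assoc V (X \<otimes> Y) Z W
        = (\<one> X \<otimes>\<^sub>m assoc V Y Z W) \<cdot> assoc V X (Y \<otimes> Z) W \<cdot> (assoc V X Y Z \<otimes>\<^sub>m \<one> W)"
    and triangle: "\<lbrakk>X \<in> Ob V; Y \<in> Ob V\<rbrakk>
      \<Longrightarrow> (\<one> X \<otimes>\<^sub>m lunit V Y) \<cdot> assoc V X \<I> Y = runit V X \<otimes>\<^sub>m \<one> Y"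

text \<open>The types \<open>'o\<close>, \<open>'m\<close> are those of the objects and morphisms of the acting monoidal category.\<close>

record ('p, 'n, 'o, 'm) module_cat = "('p, 'n) cat" +
  act_ob :: "'o \<Rightarrow> 'p \<Rightarrow> 'p" (infixr "\<odot>\<index>" 70)
  act_mor :: "'m \<Rightarrow> 'n \<Rightarrow> 'n" (infixr "\<odot>\<^sub>m\<index>" 70)
  act_assoc :: "'o \<Rightarrow> 'o \<Rightarrow> 'p \<Rightarrow> 'n"
  act_lunit :: "'p \<Rightarrow> 'n"

locale module_category =
  V: monoidal_category V + S: category S
  for V :: "('o, 'm, 'y) monoidal_cat_scheme"
    and S :: "('p, 'n, 'o, 'm, 'z) module_cat_scheme" +
  assumes act_functor:
      "cat_functor (product_cat V S) S (\<lambda>(K, X). K \<odot>\<^bsub>S\<^esub> X) (\<lambda>(u, f). u \<odot>\<^sub>m\<^bsub>S\<^esub> f)"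
    and act_assoc_iso: "\<lbrakk>K \<in> Ob V; L \<in> Ob V; X \<in> Ob S\<rbrakk>
      \<Longrightarrow> act_assoc S K L X \<in> iso_hom S ((K \<otimes>\<^bsub>V\<^esub> L) \<odot>\<^bsub>S\<^esub> X) (K \<odot>\<^bsub>S\<^esub> (L \<odot>\<^bsub>S\<^esub> X))"
    and act_assoc_natural: "\<lbrakk>u \<in> hom V K K'; v \<in> hom V L L'; f \<in> hom S X X'\<rbrakk>
      \<Longrightarrow> act_assoc S K' L' X' \<cdot>\<^bsub>S\<^esub> ((u \<otimes>\<^sub>m\<^bsub>V\<^esub> v) \<odot>\<^sub>m\<^bsub>S\<^esub> f)
        = (u \<odot>\<^sub>m\<^bsub>S\<^esub> (v \<odot>\<^sub>m\<^bsub>S\<^esub> f)) \<cdot>\<^bsub>S\<^esub> act_assoc S K L X"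
    and act_lunit_iso: "X \<in> Ob S \<Longrightarrow> act_lunit S X \<in> iso_hom S (\<I>\<^bsub>V\<^esub> \<odot>\<^bsub>S\<^esub> X) X"
    and act_lunit_natural: "f \<in> hom S X X'
      \<Longrightarrow> act_lunit S X' \<cdot>\<^bsub>S\<^esub> (\<one>\<^bsub>V\<^esub> \<I>\<^bsub>V\<^esub> \<odot>\<^sub>m\<^bsub>S\<^esub> f) = f \<cdot>\<^bsub>S\<^esub> act_lunit S X"
    and act_pentagon: "\<lbrakk>K \<in> Ob V; L \<in> Ob V; M \<in> Ob V; X \<in> Ob S\<rbrakk>
      \<Longrightarrow> act_assoc S K L (M \<odot>\<^bsub>S\<^esub> X) \<cdot>\<^bsub>S\<^esub> act_assoc S (K \<otimes>\<^bsub>V\<^esub> L) M X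
        = (\<one>\<^bsub>V\<^esub> K \<odot>\<^sub>m\<^bsub>S\<^esub> act_assoc S L M X) \<cdot>\<^bsub>S\<^esub> act_assoc S K (L \<otimes>\<^bsub>V\<^esub> M) X
            \<cdot>\<^bsub>S\<^esub> (assoc V K L M \<odot>\<^sub>m\<^bsub>S\<^esub> \<one>\<^bsub>S\<^esub> X)"
    and act_triangle: "\<lbrakk>K \<in> Ob V; X \<in> Ob S\<rbrakk>
      \<Longrightarrow> (\<one>\<^bsub>V\<^esub> K \<odot>\<^sub>m\<^bsub>S\<^esub> act_lunit S X) \<cdot>\<^bsub>S\<^esub> act_assoc S K \<I>\<^bsub>V\<^esub> X
        = runit V K \<odot>\<^sub>m\<^bsub>S\<^esub> \<one>\<^bsub>S\<^esub> X"

text \<open>Since \<open>H\<close> is contravariant in its first argument, \<open>H\<^sub>m f g\<close> is a morphism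
  \<open>H\<^sub>o X Y \<rightarrow> H\<^sub>o X' Y'\<close> for \<open>f : X' \<rightarrow> X\<close> and \<open>g : Y \<rightarrow> Y'\<close>; the partial functors
  \<open>H(f, Z)\<close> and \<open>H(X, g)\<close> are \<open>H\<^sub>m f (\<one> Z)\<close> and \<open>H\<^sub>m (\<one> X) g\<close>.\<close>

locale tensor_closed_module = module_category V S
  for V :: "('o, 'm, 'y) monoidal_cat_scheme"
    and S :: "('p, 'n, 'o, 'm, 'z) module_cat_scheme" +
  fixes H\<^sub>o :: "'p \<Rightarrow> 'p \<Rightarrow> 'o" and H\<^sub>m :: "'n \<Rightarrow> 'n \<Rightarrow> 'm"
    and \<phi> :: "'o \<Rightarrow> 'p \<Rightarrow> 'p \<Rightarrow> 'n \<Rightarrow> 'm"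
  assumes hom_functor:
      "cat_functor (product_cat (opposite_cat S) S) V (\<lambda>(X, Y). H\<^sub>o X Y) (\<lambda>(f, g). H\<^sub>m f g)"
    and \<phi>_bij: "\<lbrakk>K \<in> Ob V; X \<in> Ob S; Y \<in> Ob S\<rbrakk>
      \<Longrightarrow> bij_betw (\<phi> K X Y) (hom S (K \<odot>\<^bsub>S\<^esub> X) Y) (hom V K (H\<^sub>o X Y))"
    and \<phi>_natural: "\<lbrakk>u \<in> hom V K' K; f \<in> hom S X' X; g \<in> hom S Y Y'; h \<in> hom S (K \<odot>\<^bsub>S\<^esub> X) Y\<rbrakk>
      \<Longrightarrow> \<phi> K' X' Y' (g \<cdot>\<^bsub>S\<^esub> h \<cdot>\<^bsub>S\<^esub> (u \<odot>\<^sub>m\<^bsub>S\<^esub> f)) = H\<^sub>m f g \<cdot>\<^bsub>V\<^esub> \<phi> K X Y h \<cdot>\<^bsub>V\<^esub> u"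

text \<open>The component at \<open>Y\<close> of the counit of the adjunction \<open>- \<odot> X \<stileturn> H\<^sub>o X -\<close>, that is,
  the morphism \<open>H\<^sub>o X Y \<odot> X \<rightarrow> Y\<close> that \<open>\<phi>\<close> sends to the identity of \<open>H\<^sub>o X Y\<close>.\<close>

definition counit ::
  "('o, 'm, 'y) monoidal_cat_scheme \<Rightarrow> ('p, 'n, 'o, 'm, 'z) module_cat_scheme \<Rightarrow>
   ('p \<Rightarrow> 'p \<Rightarrow> 'o) \<Rightarrow> ('o \<Rightarrow> 'p \<Rightarrow> 'p \<Rightarrow> 'n \<Rightarrow> 'm) \<Rightarrow> 'p \<Rightarrow> 'p \<Rightarrow> 'n" where
  "counit V S H\<^sub>o \<phi> X Y =
     the_inv_into (hom S (H\<^sub>o X Y \<odot>\<^bsub>S\<^esub> X) Y) (\<phi> (H\<^sub>o X Y) X Y) (\<one>\<^bsub>V\<^esub> (H\<^sub>o X Y))"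

locale V_structure =
  V: monoidal_category V + S: category S
  for V :: "('o, 'm, 'y) monoidal_cat_scheme" and S :: "('p, 'n, 'z) cat_scheme" +
  fixes H\<^sub>o :: "'p \<Rightarrow> 'p \<Rightarrow> 'o" and H\<^sub>m :: "'n \<Rightarrow> 'n \<Rightarrow> 'm"
    and bullet :: "'p \<Rightarrow> 'p \<Rightarrow> 'p \<Rightarrow> 'm"
    and \<phi> :: "'p \<Rightarrow> 'p \<Rightarrow> 'n \<Rightarrow> 'm"
  assumes hom_functor:
      "cat_functor (product_cat (opposite_cat S) S) V (\<lambda>(X, Y). H\<^sub>o X Y) (\<lambda>(f, g). H\<^sub>m f g)"
    and bullet_in_hom: "\<lbrakk>X \<in> Ob S; Y \<in> Ob S; Z \<in> Ob S\<rbrakk>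
      \<Longrightarrow> bullet X Y Z \<in> hom V (H\<^sub>o Y Z \<otimes>\<^bsub>V\<^esub> H\<^sub>o X Y) (H\<^sub>o X Z)"
    and \<phi>_bij: "\<lbrakk>X \<in> Ob S; Y \<in> Ob S\<rbrakk>
      \<Longrightarrow> bij_betw (\<phi> X Y) (hom S X Y) (hom V \<I>\<^bsub>V\<^esub> (H\<^sub>o X Y))"
    and \<phi>_natural: "\<lbrakk>f \<in> hom S X' X; g \<in> hom S Y Y'; h \<in> hom S X Y\<rbrakk>
      \<Longrightarrow> \<phi> X' Y' (g \<cdot>\<^bsub>S\<^esub> h \<cdot>\<^bsub>S\<^esub> f) = H\<^sub>m f g \<cdot>\<^bsub>V\<^esub> \<phi> X Y h"
    and bullet_assoc: "\<lbrakk>X \<in> Ob S; Y \<in> Ob S; Z \<in> Ob S; W \<in> Ob S\<rbrakk>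
      \<Longrightarrow> bullet X Y W \<cdot>\<^bsub>V\<^esub> (bullet Y Z W \<otimes>\<^sub>m\<^bsub>V\<^esub> \<one>\<^bsub>V\<^esub> (H\<^sub>o X Y))
        = bullet X Z W \<cdot>\<^bsub>V\<^esub> (\<one>\<^bsub>V\<^esub> (H\<^sub>o Z W) \<otimes>\<^sub>m\<^bsub>V\<^esub> bullet X Y Z)
            \<cdot>\<^bsub>V\<^esub> assoc V (H\<^sub>o Z W) (H\<^sub>o Y Z) (H\<^sub>o X Y)"
    and bullet_right: "\<lbrakk>f \<in> hom S X Y; Z \<in> Ob S\<rbrakk>
      \<Longrightarrow> H\<^sub>m f (\<one>\<^bsub>S\<^esub> Z)
        = bullet X Y Z \<cdot>\<^bsub>V\<^esub> (\<one>\<^bsub>V\<^esub> (H\<^sub>o Y Z) \<otimes>\<^sub>m\<^bsub>V\<^esub> \<phi> X Y f)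
            \<cdot>\<^bsub>V\<^esub> inverse_mor V (runit V (H\<^sub>o Y Z))"
    and bullet_left: "\<lbrakk>g \<in> hom S Y Z; X \<in> Ob S\<rbrakk>
      \<Longrightarrow> H\<^sub>m (\<one>\<^bsub>S\<^esub> X) g
        = bullet X Y Z \<cdot>\<^bsub>V\<^esub> (\<phi> Y Z g \<otimes>\<^sub>m\<^bsub>V\<^esub> \<one>\<^bsub>V\<^esub> (H\<^sub>o X Y))
            \<cdot>\<^bsub>V\<^esub> inverse_mor V (lunit V (H\<^sub>o X Y))"

end

theory Submission
  imports Defs
begin

text \<open>A morphism \<open>u : K \<rightarrow> H X Y\<close> is determined by its transpose \<open>\<epsilon> \<cdot> (u \<odot> 1)\<close>, so each axiom
  may be checked after transposing. The transpose of the composition is \<open>\<epsilon> \<cdot> (1 \<odot> \<epsilon>) \<cdot> a\<close>, that of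
  \<open>\<phi>\<close> on the unit is \<open>f \<cdot> l\<close>, and that of \<open>H f g\<close> is \<open>g \<cdot> \<epsilon> \<cdot> (1 \<odot> f)\<close>. Associativity then reduces to
  the pentagon, and compatibility with \<open>H f Z\<close> to the triangle. Compatibility with \<open>H X g\<close>
  requires the left unit triangle \<open>l \<cdot> a = l \<odot> 1\<close>, which is not an axiom of a module; it
  follows from the axioms by the argument Kelly gave for monoidal categories.\<close>

section \<open>Typing rules and inverses in a category\<close>

lemma hom_iff: "f \<in> hom C X Y \<longleftrightarrow> f \<in> Mor C \<and> Dom C f = X \<and> Cod C f = Y"
  by (simp add: hom_def)

context category
begin

declare Dom_in_Ob [simp] Cod_in_Ob [simp]

text \<open>Rules about hom-sets leave the middle object of a composite to be guessed. Stated
  through \<open>Dom\<close> and \<open>Cod\<close>, typing becomes a computation that the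
  simplifier can carry out.\<close>

lemma Comp_Mor [simp]:
  assumes "f \<in> Mor C" "g \<in> Mor C" "Dom C g = Cod C f"
  shows "g \<cdot> f \<in> Mor C" "Dom C (g \<cdot> f) = Dom C f" "Cod C (g \<cdot> f) = Cod C g"
  using Comp_in_hom[of f "Dom C f" "Cod C f" g "Cod C g"] assms by (simp_all add: hom_iff)

text \<open>As a simp rule this brings every composite into right-nested form. Later steps undo it
  where an equation needs a bracket on the left.\<close>

lemma Comp_assoc_Mor [simp]:
  "\<lbrakk>f \<in> Mor C; g \<in> Mor C; h \<in> Mor C; Dom C g = Cod C f; Dom C h = Cod C g\<rbrakk>
    \<Longrightarrow> (h \<cdot> g) \<cdot> f = h \<cdot> (g \<cdot> f)"
  using Comp_assoc by (simp add: hom_iff)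

lemma Id_Mor [simp]:
  assumes "X \<in> Ob C"
  shows "\<one> X \<in> Mor C" "Dom C (\<one> X) = X" "Cod C (\<one> X) = X"
  using Id_in_hom[OF assms] by (simp_all add: hom_iff)

lemma Id_Comp [simp]: "\<lbrakk>f \<in> Mor C; Cod C f = X\<rbrakk> \<Longrightarrow> \<one> X \<cdot> f = f"
  using Id_left[of f "Dom C f" X] by (simp add: hom_iff)

lemma Comp_Id [simp]: "\<lbrakk>f \<in> Mor C; Dom C f = X\<rbrakk> \<Longrightarrow> f \<cdot> \<one> X = f"
  using Id_right[of f X "Cod C f"] by (simp add: hom_iff)

text \<open>The usual chain \<open>g = g (f h) = (g f) h = h\<close>. It makes the definite
  description in \<open>inverse_mor\<close> meaningful.\<close>

lemma inverse_pair_unique: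
  assumes "inverse_pair C f g" "inverse_pair C f h"
  shows "g = h"
proof -
  have "g = g \<cdot> (f \<cdot> h)" using assms by (simp add: inverse_pair_def hom_iff)
  also have "\<dots> = (g \<cdot> f) \<cdot> h"
    using assms unfolding inverse_pair_def hom_iff by (intro Comp_assoc_Mor[symmetric]) auto
  also have "\<dots> = h" using assms by (simp add: inverse_pair_def hom_iff)
  finally show ?thesis .
qed

lemma inverse_mor:
  assumes "f \<in> iso_hom C X Y"
  shows "inverse_mor C f \<in> Mor C" "Dom C (inverse_mor C f) = Y" "Cod C (inverse_mor C f) = X"
    "inverse_mor C f \<cdot> f = \<one> X" "f \<cdot> inverse_mor C f = \<one> Y"
proof -
  from assms obtain g where "inverse_pair C f g" by (auto simp: iso_hom_def)
  then have "inverse_pair C f (inverse_mor C f)"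
    unfolding inverse_mor_def by (rule theI) (blast intro: inverse_pair_unique \<open>inverse_pair C f g\<close>)
  with assms show "inverse_mor C f \<in> Mor C" "Dom C (inverse_mor C f) = Y"
    "Cod C (inverse_mor C f) = X" "inverse_mor C f \<cdot> f = \<one> X" "f \<cdot> inverse_mor C f = \<one> Y"
    by (auto simp: iso_hom_def inverse_pair_def hom_iff)
qed

lemma iso_hom_Mor:
  assumes "f \<in> iso_hom C X Y"
  shows "f \<in> Mor C" "Dom C f = X" "Cod C f = Y"
  using assms by (auto simp: iso_hom_def hom_iff)

lemma iso_cancel_right:
  assumes "f \<in> iso_hom C X Y" "g \<in> hom C Y Z" "h \<in> hom C Y Z" "g \<cdot> f = h \<cdot> f"
  shows "g = h"
proof -
  have "g \<cdot> (f \<cdot> inverse_mor C f) = h \<cdot> (f \<cdot> inverse_mor C f)"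
    using assms iso_hom_Mor[OF assms(1)] inverse_mor(1-3)[OF assms(1)] Comp_assoc_Mor
    by (metis hom_iff)
  then show ?thesis using assms by (simp add: inverse_mor(5) hom_iff)
qed

end

section \<open>Typing rules in a monoidal category\<close>

context monoidal_category
begin

interpretation T: cat_functor "product_cat V V" V "\<lambda>(X, Y). X \<otimes> Y" "\<lambda>(f, g). f \<otimes>\<^sub>m g"
  by (rule tensor_functor)

lemma tensor_Ob [simp]: "\<lbrakk>X \<in> Ob V; Y \<in> Ob V\<rbrakk> \<Longrightarrow> X \<otimes> Y \<in> Ob V"
  using T.ob_in_Ob[of "(X, Y)"] by (simp add: product_cat_def)

declare unit_in_Ob [simp]

lemma tensor_Id: "\<lbrakk>X \<in> Ob V; Y \<in> Ob V\<rbrakk> \<Longrightarrow> \<one> X \<otimes>\<^sub>m \<one> Y = \<one> (X \<otimes> Y)"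
  using T.preserves_Id[of "(X, Y)"] by (simp add: product_cat_def)

lemma tensor_Mor [simp]:
  assumes "f \<in> Mor V" "g \<in> Mor V"
  shows "f \<otimes>\<^sub>m g \<in> Mor V" "Dom V (f \<otimes>\<^sub>m g) = Dom V f \<otimes> Dom V g"
    "Cod V (f \<otimes>\<^sub>m g) = Cod V f \<otimes> Cod V g"
  using T.mor_in_hom[of "(f, g)" "(Dom V f, Dom V g)" "(Cod V f, Cod V g)"] assms
  by (simp_all add: product_cat_def hom_iff)

lemma assoc_Mor [simp]:
  assumes "X \<in> Ob V" "Y \<in> Ob V" "Z \<in> Ob V"
  shows "assoc V X Y Z \<in> Mor V" "Dom V (assoc V X Y Z) = (X \<otimes> Y) \<otimes> Z"
    "Cod V (assoc V X Y Z) = X \<otimes> (Y \<otimes> Z)"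
  using iso_hom_Mor[OF assoc_iso[OF assms]] by auto

lemma lunit_Mor [simp]:
  assumes "X \<in> Ob V"
  shows "lunit V X \<in> Mor V" "Dom V (lunit V X) = \<I> \<otimes> X" "Cod V (lunit V X) = X"
  using iso_hom_Mor[OF lunit_iso[OF assms]] by auto

lemma runit_Mor [simp]:
  assumes "X \<in> Ob V"
  shows "runit V X \<in> Mor V" "Dom V (runit V X) = X \<otimes> \<I>" "Cod V (runit V X) = X"
  using iso_hom_Mor[OF runit_iso[OF assms]] by auto

end

section \<open>Functoriality and naturality of the action\<close>

context module_category
begin

interpretation T: cat_functor "product_cat V S" S "\<lambda>(K, X). K \<odot>\<^bsub>S\<^esub> X" "\<lambda>(u, f). u \<odot>\<^sub>m\<^bsub>S\<^esub> f"
  by (rule act_functor)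

lemma act_Ob [simp]: "\<lbrakk>K \<in> Ob V; X \<in> Ob S\<rbrakk> \<Longrightarrow> K \<odot>\<^bsub>S\<^esub> X \<in> Ob S"
  using T.ob_in_Ob[of "(K, X)"] by (simp add: product_cat_def)

lemma act_Mor [simp]:
  assumes "u \<in> Mor V" "f \<in> Mor S"
  shows "u \<odot>\<^sub>m\<^bsub>S\<^esub> f \<in> Mor S" "Dom S (u \<odot>\<^sub>m\<^bsub>S\<^esub> f) = Dom V u \<odot>\<^bsub>S\<^esub> Dom S f"
    "Cod S (u \<odot>\<^sub>m\<^bsub>S\<^esub> f) = Cod V u \<odot>\<^bsub>S\<^esub> Cod S f"
  using T.mor_in_hom[of "(u, f)" "(Dom V u, Dom S f)" "(Cod V u, Cod S f)"] assms
  by (simp_all add: product_cat_def hom_iff)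

lemma act_Id [simp]: "\<lbrakk>K \<in> Ob V; X \<in> Ob S\<rbrakk> \<Longrightarrow> \<one>\<^bsub>V\<^esub> K \<odot>\<^sub>m\<^bsub>S\<^esub> \<one>\<^bsub>S\<^esub> X = \<one>\<^bsub>S\<^esub> (K \<odot>\<^bsub>S\<^esub> X)"
  using T.preserves_Id[of "(K, X)"] by (simp add: product_cat_def)

lemma act_Comp:
  assumes "u \<in> Mor V" "v \<in> Mor V" "Dom V v = Cod V u"
    and "f \<in> Mor S" "g \<in> Mor S" "Dom S g = Cod S f"
  shows "(v \<odot>\<^sub>m\<^bsub>S\<^esub> g) \<cdot>\<^bsub>S\<^esub> (u \<odot>\<^sub>m\<^bsub>S\<^esub> f) = (v \<cdot>\<^bsub>V\<^esub> u) \<odot>\<^sub>m\<^bsub>S\<^esub> (g \<cdot>\<^bsub>S\<^esub> f)"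
  using T.preserves_Comp[of "(u, f)" "(Dom V u, Dom S f)" "(Cod V u, Cod S f)" "(v, g)"
      "(Cod V v, Cod S g)"] assms
  by (simp add: product_cat_def hom_iff)

text \<open>The interchange law with a tail \<open>h\<close>: in a right-nested chain two adjacent
  factors never form a subterm of their own, so \<open>act_Comp\<close> matches only at the end of
  the chain.\<close>

lemma act_Comp_Comp:
  assumes "u \<in> Mor V" "v \<in> Mor V" "Dom V v = Cod V u"
    and "f \<in> Mor S" "g \<in> Mor S" "Dom S g = Cod S f"
    and "h \<in> Mor S" "Cod S h = Dom V u \<odot>\<^bsub>S\<^esub> Dom S f"
  shows "(v \<odot>\<^sub>m\<^bsub>S\<^esub> g) \<cdot>\<^bsub>S\<^esub> (u \<odot>\<^sub>m\<^bsub>S\<^esub> f) \<cdot>\<^bsub>S\<^esub> h = ((v \<cdot>\<^bsub>V\<^esub> u) \<odot>\<^sub>m\<^bsub>S\<^esub> (g \<cdot>\<^bsub>S\<^esub> f)) \<cdot>\<^bsub>S\<^esub> h"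
  using assms by (simp flip: act_Comp)

lemma act_assoc_Mor [simp]:
  assumes "K \<in> Ob V" "L \<in> Ob V" "X \<in> Ob S"
  shows "act_assoc S K L X \<in> Mor S" "Dom S (act_assoc S K L X) = (K \<otimes>\<^bsub>V\<^esub> L) \<odot>\<^bsub>S\<^esub> X"
    "Cod S (act_assoc S K L X) = K \<odot>\<^bsub>S\<^esub> (L \<odot>\<^bsub>S\<^esub> X)"
  using S.iso_hom_Mor[OF act_assoc_iso[OF assms]] by auto

lemma act_lunit_Mor [simp]:
  assumes "X \<in> Ob S"
  shows "act_lunit S X \<in> Mor S" "Dom S (act_lunit S X) = \<I>\<^bsub>V\<^esub> \<odot>\<^bsub>S\<^esub> X" "Cod S (act_lunit S X) = X"
  using S.iso_hom_Mor[OF act_lunit_iso[OF assms]] by auto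

lemma act_assoc_natural_Mor:
  assumes "u \<in> Mor V" "v \<in> Mor V" "f \<in> Mor S" "Cod V u = K" "Cod V v = L" "Cod S f = X"
  shows "act_assoc S K L X \<cdot>\<^bsub>S\<^esub> ((u \<otimes>\<^sub>m\<^bsub>V\<^esub> v) \<odot>\<^sub>m\<^bsub>S\<^esub> f)
    = (u \<odot>\<^sub>m\<^bsub>S\<^esub> (v \<odot>\<^sub>m\<^bsub>S\<^esub> f)) \<cdot>\<^bsub>S\<^esub> act_assoc S (Dom V u) (Dom V v) (Dom S f)"
  using act_assoc_natural[of u "Dom V u" K v "Dom V v" L f "Dom S f" X] assms
  by (simp add: hom_iff)

lemma act_assoc_natural_Comp:
  assumes "u \<in> Mor V" "v \<in> Mor V" "f \<in> Mor S" "Cod V u = K" "Cod V v = L" "Cod S f = X"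
    and "h \<in> Mor S" "Cod S h = (Dom V u \<otimes>\<^bsub>V\<^esub> Dom V v) \<odot>\<^bsub>S\<^esub> Dom S f"
  shows "act_assoc S K L X \<cdot>\<^bsub>S\<^esub> ((u \<otimes>\<^sub>m\<^bsub>V\<^esub> v) \<odot>\<^sub>m\<^bsub>S\<^esub> f) \<cdot>\<^bsub>S\<^esub> h
    = (u \<odot>\<^sub>m\<^bsub>S\<^esub> (v \<odot>\<^sub>m\<^bsub>S\<^esub> f)) \<cdot>\<^bsub>S\<^esub> act_assoc S (Dom V u) (Dom V v) (Dom S f) \<cdot>\<^bsub>S\<^esub> h"
proof -
  have "act_assoc S K L X \<cdot>\<^bsub>S\<^esub> ((u \<otimes>\<^sub>m\<^bsub>V\<^esub> v) \<odot>\<^sub>m\<^bsub>S\<^esub> f) \<cdot>\<^bsub>S\<^esub> h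
      = (act_assoc S K L X \<cdot>\<^bsub>S\<^esub> ((u \<otimes>\<^sub>m\<^bsub>V\<^esub> v) \<odot>\<^sub>m\<^bsub>S\<^esub> f)) \<cdot>\<^bsub>S\<^esub> h"
    using assms by (intro S.Comp_assoc_Mor[symmetric]) auto
  then show ?thesis using assms by (simp add: act_assoc_natural_Mor)
qed

lemma act_lunit_natural_Mor:
  assumes "f \<in> Mor S" "Cod S f = X"
  shows "act_lunit S X \<cdot>\<^bsub>S\<^esub> (\<one>\<^bsub>V\<^esub> \<I>\<^bsub>V\<^esub> \<odot>\<^sub>m\<^bsub>S\<^esub> f) = f \<cdot>\<^bsub>S\<^esub> act_lunit S (Dom S f)"
  using act_lunit_natural[of f "Dom S f" X] assms by (simp add: hom_iff)

section \<open>The left unit triangle of a module\<close>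

text \<open>Naturality of \<open>l\<close> expresses \<open>f \<cdot> l\<close> through the action
  of the unit on \<open>f\<close>, and the isomorphism \<open>l\<close> cancels.\<close>

lemma unit_act_faithful:
  assumes "f \<in> hom S X Y" "g \<in> hom S X Y" "\<one>\<^bsub>V\<^esub> \<I>\<^bsub>V\<^esub> \<odot>\<^sub>m\<^bsub>S\<^esub> f = \<one>\<^bsub>V\<^esub> \<I>\<^bsub>V\<^esub> \<odot>\<^sub>m\<^bsub>S\<^esub> g"
  shows "f = g"
proof -
  have "f \<cdot>\<^bsub>S\<^esub> act_lunit S X = g \<cdot>\<^bsub>S\<^esub> act_lunit S X"
    using act_lunit_natural[OF assms(1)] act_lunit_natural[OF assms(2)] assms(3) by simp
  moreover have "X \<in> Ob S" using assms(1) by (auto simp: hom_iff)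
  ultimately show ?thesis using S.iso_cancel_right act_lunit_iso assms by metis
qed

lemma iso_act_Id:
  assumes "u \<in> iso_hom V K L" "X \<in> Ob S"
  shows "u \<odot>\<^sub>m\<^bsub>S\<^esub> \<one>\<^bsub>S\<^esub> X \<in> iso_hom S (K \<odot>\<^bsub>S\<^esub> X) (L \<odot>\<^bsub>S\<^esub> X)"
proof -
  note u = V.iso_hom_Mor[OF assms(1)] V.inverse_mor[OF assms(1)]
  have "K \<in> Ob V" "L \<in> Ob V" using u V.Dom_in_Ob V.Cod_in_Ob by metis+
  then have "inverse_pair S (u \<odot>\<^sub>m\<^bsub>S\<^esub> \<one>\<^bsub>S\<^esub> X) (inverse_mor V u \<odot>\<^sub>m\<^bsub>S\<^esub> \<one>\<^bsub>S\<^esub> X)"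
    using assms u by (simp add: inverse_pair_def hom_iff act_Comp)
  then show ?thesis using assms u by (auto simp: iso_hom_def hom_iff)
qed

text \<open>By faithfulness of the unit action it suffices to compare the two sides after acting
  with the unit, and then after precomposing with isomorphisms. The pentagon at
  \<open>I, I, K, X\<close> links the left side to the module triangle, and the triangle of
  \<open>V\<close> links the result to the right side.\<close>

lemma act_left_triangle:
  assumes K: "K \<in> Ob V" and X: "X \<in> Ob S"
  shows "act_lunit S (K \<odot>\<^bsub>S\<^esub> X) \<cdot>\<^bsub>S\<^esub> act_assoc S \<I>\<^bsub>V\<^esub> K X = lunit V K \<odot>\<^sub>m\<^bsub>S\<^esub> \<one>\<^bsub>S\<^esub> X"
proof (rule unit_act_faithful)
  \<comment> \<open>These are the last two factors on the three-term side of the pentagon at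
    \<open>I, I, K, X\<close>; both are isomorphisms, so they can be cancelled.\<close>
  let ?A = "act_assoc S \<I>\<^bsub>V\<^esub> (\<I>\<^bsub>V\<^esub> \<otimes>\<^bsub>V\<^esub> K) X" and ?a = "assoc V \<I>\<^bsub>V\<^esub> \<I>\<^bsub>V\<^esub> K \<odot>\<^sub>m\<^bsub>S\<^esub> \<one>\<^bsub>S\<^esub> X"
  show "act_lunit S (K \<odot>\<^bsub>S\<^esub> X) \<cdot>\<^bsub>S\<^esub> act_assoc S \<I>\<^bsub>V\<^esub> K X \<in> hom S ((\<I>\<^bsub>V\<^esub> \<otimes>\<^bsub>V\<^esub> K) \<odot>\<^bsub>S\<^esub> X) (K \<odot>\<^bsub>S\<^esub> X)"
    "lunit V K \<odot>\<^sub>m\<^bsub>S\<^esub> \<one>\<^bsub>S\<^esub> X \<in> hom S ((\<I>\<^bsub>V\<^esub> \<otimes>\<^bsub>V\<^esub> K) \<odot>\<^bsub>S\<^esub> X) (K \<odot>\<^bsub>S\<^esub> X)"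
    using K X by (simp_all add: hom_iff)
  show "\<one>\<^bsub>V\<^esub> \<I>\<^bsub>V\<^esub> \<odot>\<^sub>m\<^bsub>S\<^esub> (act_lunit S (K \<odot>\<^bsub>S\<^esub> X) \<cdot>\<^bsub>S\<^esub> act_assoc S \<I>\<^bsub>V\<^esub> K X)
      = \<one>\<^bsub>V\<^esub> \<I>\<^bsub>V\<^esub> \<odot>\<^sub>m\<^bsub>S\<^esub> (lunit V K \<odot>\<^sub>m\<^bsub>S\<^esub> \<one>\<^bsub>S\<^esub> X)" (is "?l = ?r")
  proof (rule S.iso_cancel_right[where f = ?A])
    show "?A \<in> iso_hom S ((\<I>\<^bsub>V\<^esub> \<otimes>\<^bsub>V\<^esub> (\<I>\<^bsub>V\<^esub> \<otimes>\<^bsub>V\<^esub> K)) \<odot>\<^bsub>S\<^esub> X) (\<I>\<^bsub>V\<^esub> \<odot>\<^bsub>S\<^esub> ((\<I>\<^bsub>V\<^esub> \<otimes>\<^bsub>V\<^esub> K) \<odot>\<^bsub>S\<^esub> X))"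
      using K X by (intro act_assoc_iso) auto
    show "?l \<in> hom S (\<I>\<^bsub>V\<^esub> \<odot>\<^bsub>S\<^esub> ((\<I>\<^bsub>V\<^esub> \<otimes>\<^bsub>V\<^esub> K) \<odot>\<^bsub>S\<^esub> X)) (\<I>\<^bsub>V\<^esub> \<odot>\<^bsub>S\<^esub> (K \<odot>\<^bsub>S\<^esub> X))"
      "?r \<in> hom S (\<I>\<^bsub>V\<^esub> \<odot>\<^bsub>S\<^esub> ((\<I>\<^bsub>V\<^esub> \<otimes>\<^bsub>V\<^esub> K) \<odot>\<^bsub>S\<^esub> X)) (\<I>\<^bsub>V\<^esub> \<odot>\<^bsub>S\<^esub> (K \<odot>\<^bsub>S\<^esub> X))"
      using K X by (simp_all add: hom_iff)
    show "?l \<cdot>\<^bsub>S\<^esub> ?A = ?r \<cdot>\<^bsub>S\<^esub> ?A"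
    proof (rule S.iso_cancel_right[where f = ?a])
      show "?a \<in> iso_hom S (((\<I>\<^bsub>V\<^esub> \<otimes>\<^bsub>V\<^esub> \<I>\<^bsub>V\<^esub>) \<otimes>\<^bsub>V\<^esub> K) \<odot>\<^bsub>S\<^esub> X) ((\<I>\<^bsub>V\<^esub> \<otimes>\<^bsub>V\<^esub> (\<I>\<^bsub>V\<^esub> \<otimes>\<^bsub>V\<^esub> K)) \<odot>\<^bsub>S\<^esub> X)"
        using K X by (intro iso_act_Id V.assoc_iso) auto
      show "?l \<cdot>\<^bsub>S\<^esub> ?A \<in> hom S ((\<I>\<^bsub>V\<^esub> \<otimes>\<^bsub>V\<^esub> (\<I>\<^bsub>V\<^esub> \<otimes>\<^bsub>V\<^esub> K)) \<odot>\<^bsub>S\<^esub> X) (\<I>\<^bsub>V\<^esub> \<odot>\<^bsub>S\<^esub> (K \<odot>\<^bsub>S\<^esub> X))"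
        "?r \<cdot>\<^bsub>S\<^esub> ?A \<in> hom S ((\<I>\<^bsub>V\<^esub> \<otimes>\<^bsub>V\<^esub> (\<I>\<^bsub>V\<^esub> \<otimes>\<^bsub>V\<^esub> K)) \<odot>\<^bsub>S\<^esub> X) (\<I>\<^bsub>V\<^esub> \<odot>\<^bsub>S\<^esub> (K \<odot>\<^bsub>S\<^esub> X))"
        using K X by (simp_all add: hom_iff)
      have "(?l \<cdot>\<^bsub>S\<^esub> ?A) \<cdot>\<^bsub>S\<^esub> ?a = (\<one>\<^bsub>V\<^esub> \<I>\<^bsub>V\<^esub> \<odot>\<^sub>m\<^bsub>S\<^esub> act_lunit S (K \<odot>\<^bsub>S\<^esub> X))
          \<cdot>\<^bsub>S\<^esub> (\<one>\<^bsub>V\<^esub> \<I>\<^bsub>V\<^esub> \<odot>\<^sub>m\<^bsub>S\<^esub> act_assoc S \<I>\<^bsub>V\<^esub> K X) \<cdot>\<^bsub>S\<^esub> ?A \<cdot>\<^bsub>S\<^esub> ?a"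
        using K X by (simp add: act_Comp_Comp)
      \<comment> \<open>The pentagon at \<open>I, I, K, X\<close> replaces the last three factors by
        two.\<close>
      also have "\<dots> = (\<one>\<^bsub>V\<^esub> \<I>\<^bsub>V\<^esub> \<odot>\<^sub>m\<^bsub>S\<^esub> act_lunit S (K \<odot>\<^bsub>S\<^esub> X))
          \<cdot>\<^bsub>S\<^esub> act_assoc S \<I>\<^bsub>V\<^esub> \<I>\<^bsub>V\<^esub> (K \<odot>\<^bsub>S\<^esub> X) \<cdot>\<^bsub>S\<^esub> act_assoc S (\<I>\<^bsub>V\<^esub> \<otimes>\<^bsub>V\<^esub> \<I>\<^bsub>V\<^esub>) K X"
        using K X by (simp add: act_pentagon)
      also have "\<dots> = ((\<one>\<^bsub>V\<^esub> \<I>\<^bsub>V\<^esub> \<odot>\<^sub>m\<^bsub>S\<^esub> act_lunit S (K \<odot>\<^bsub>S\<^esub> X))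
          \<cdot>\<^bsub>S\<^esub> act_assoc S \<I>\<^bsub>V\<^esub> \<I>\<^bsub>V\<^esub> (K \<odot>\<^bsub>S\<^esub> X)) \<cdot>\<^bsub>S\<^esub> act_assoc S (\<I>\<^bsub>V\<^esub> \<otimes>\<^bsub>V\<^esub> \<I>\<^bsub>V\<^esub>) K X"
        using K X by (intro S.Comp_assoc_Mor[symmetric]) auto
      \<comment> \<open>The module triangle at \<open>I\<close> and \<open>K \<odot> X\<close>. The
        identity of \<open>K \<odot> X\<close> is written as an action of identities so that
        naturality of the associativity applies next; deleting \<open>act_Id\<close> there keeps it
        split.\<close>
      also have "\<dots> = (runit V \<I>\<^bsub>V\<^esub> \<odot>\<^sub>m\<^bsub>S\<^esub> (\<one>\<^bsub>V\<^esub> K \<odot>\<^sub>m\<^bsub>S\<^esub> \<one>\<^bsub>S\<^esub> X)) \<cdot>\<^bsub>S\<^esub> act_assoc S (\<I>\<^bsub>V\<^esub> \<otimes>\<^bsub>V\<^esub> \<I>\<^bsub>V\<^esub>) K X"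
        using K X by (simp add: act_triangle)
      also have "\<dots> = act_assoc S \<I>\<^bsub>V\<^esub> K X \<cdot>\<^bsub>S\<^esub> ((runit V \<I>\<^bsub>V\<^esub> \<otimes>\<^sub>m\<^bsub>V\<^esub> \<one>\<^bsub>V\<^esub> K) \<odot>\<^sub>m\<^bsub>S\<^esub> \<one>\<^bsub>S\<^esub> X)"
        using K X by (simp add: act_assoc_natural_Mor del: act_Id)
      \<comment> \<open>The triangle of \<open>V\<close> at \<open>I, K\<close>, read from right to
        left.\<close>
      also have "\<dots> = act_assoc S \<I>\<^bsub>V\<^esub> K X \<cdot>\<^bsub>S\<^esub> (((\<one>\<^bsub>V\<^esub> \<I>\<^bsub>V\<^esub> \<otimes>\<^sub>m\<^bsub>V\<^esub> lunit V K) \<cdot>\<^bsub>V\<^esub> assoc V \<I>\<^bsub>V\<^esub> \<I>\<^bsub>V\<^esub> K) \<odot>\<^sub>m\<^bsub>S\<^esub> \<one>\<^bsub>S\<^esub> X)"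
        using K by (simp add: V.triangle)
      also have "\<dots> = act_assoc S \<I>\<^bsub>V\<^esub> K X \<cdot>\<^bsub>S\<^esub> ((\<one>\<^bsub>V\<^esub> \<I>\<^bsub>V\<^esub> \<otimes>\<^sub>m\<^bsub>V\<^esub> lunit V K) \<odot>\<^sub>m\<^bsub>S\<^esub> \<one>\<^bsub>S\<^esub> X) \<cdot>\<^bsub>S\<^esub> ?a"
        using K X by (simp add: act_Comp)
      \<comment> \<open>Naturality of the associativity in its middle argument, at
        \<open>lunit V K\<close>.\<close>
      also have "\<dots> = (?r \<cdot>\<^bsub>S\<^esub> ?A) \<cdot>\<^bsub>S\<^esub> ?a"
        using K X by (simp add: act_assoc_natural_Comp)
      finally show "(?l \<cdot>\<^bsub>S\<^esub> ?A) \<cdot>\<^bsub>S\<^esub> ?a = (?r \<cdot>\<^bsub>S\<^esub> ?A) \<cdot>\<^bsub>S\<^esub> ?a" .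
    qed
  qed
qed

end

section \<open>Transposition along the counit\<close>

context tensor_closed_module
begin

interpretation H: cat_functor "product_cat (opposite_cat S) S" V "\<lambda>(X, Y). H\<^sub>o X Y"
  "\<lambda>(f, g). H\<^sub>m f g"
  by (rule hom_functor)

lemma hom_Ob [simp]: "\<lbrakk>X \<in> Ob S; Y \<in> Ob S\<rbrakk> \<Longrightarrow> H\<^sub>o X Y \<in> Ob V"
  using H.ob_in_Ob[of "(X, Y)"] by (simp add: product_cat_def opposite_cat_def)

lemma hom_Mor [simp]:
  assumes "f \<in> Mor S" "g \<in> Mor S"
  shows "H\<^sub>m f g \<in> Mor V" "Dom V (H\<^sub>m f g) = H\<^sub>o (Cod S f) (Dom S g)"
    "Cod V (H\<^sub>m f g) = H\<^sub>o (Dom S f) (Cod S g)"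
  using H.mor_in_hom[of "(f, g)" "(Cod S f, Dom S g)" "(Dom S f, Cod S g)"] assms
  by (simp_all add: product_cat_def opposite_cat_def hom_iff)

lemma hom_Id [simp]: "\<lbrakk>X \<in> Ob S; Y \<in> Ob S\<rbrakk> \<Longrightarrow> H\<^sub>m (\<one>\<^bsub>S\<^esub> X) (\<one>\<^bsub>S\<^esub> Y) = \<one>\<^bsub>V\<^esub> (H\<^sub>o X Y)"
  using H.preserves_Id[of "(X, Y)"] by (simp add: product_cat_def opposite_cat_def)

lemma \<phi>_Mor [simp]:
  assumes "K \<in> Ob V" "X \<in> Ob S" "Y \<in> Ob S" "h \<in> Mor S" "Dom S h = K \<odot>\<^bsub>S\<^esub> X" "Cod S h = Y"
  shows "\<phi> K X Y h \<in> Mor V" "Dom V (\<phi> K X Y h) = K" "Cod V (\<phi> K X Y h) = H\<^sub>o X Y"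
  using bij_betwE[OF \<phi>_bij[of K X Y]] assms by (auto simp: hom_iff)

abbreviation ev :: "'p \<Rightarrow> 'p \<Rightarrow> 'n" ("\<epsilon>") where
  "\<epsilon> \<equiv> counit V S H\<^sub>o \<phi>"

text \<open>The identity of \<open>H\<^sub>o X Y\<close> lies in the range of the bijection, so its
  preimage exists and has the expected type.\<close>

lemma counit_hom:
  assumes "X \<in> Ob S" "Y \<in> Ob S"
  shows "\<epsilon> X Y \<in> hom S (H\<^sub>o X Y \<odot>\<^bsub>S\<^esub> X) Y" "\<phi> (H\<^sub>o X Y) X Y (\<epsilon> X Y) = \<one>\<^bsub>V\<^esub> (H\<^sub>o X Y)"
proof -
  have bij: "bij_betw (\<phi> (H\<^sub>o X Y) X Y) (hom S (H\<^sub>o X Y \<odot>\<^bsub>S\<^esub> X) Y) (hom V (H\<^sub>o X Y) (H\<^sub>o X Y))"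
    using assms by (intro \<phi>_bij) auto
  have 1: "\<one>\<^bsub>V\<^esub> (H\<^sub>o X Y) \<in> hom V (H\<^sub>o X Y) (H\<^sub>o X Y)" using assms by (simp add: hom_iff)
  show "\<epsilon> X Y \<in> hom S (H\<^sub>o X Y \<odot>\<^bsub>S\<^esub> X) Y"
    unfolding counit_def using bij 1 by (metis bij_betw_def the_inv_into_into subset_refl)
  show "\<phi> (H\<^sub>o X Y) X Y (\<epsilon> X Y) = \<one>\<^bsub>V\<^esub> (H\<^sub>o X Y)"
    unfolding counit_def using bij 1 by (rule f_the_inv_into_f_bij_betw)
qed

lemma counit_Mor [simp]:
  assumes "X \<in> Ob S" "Y \<in> Ob S"
  shows "\<epsilon> X Y \<in> Mor S" "Dom S (\<epsilon> X Y) = H\<^sub>o X Y \<odot>\<^bsub>S\<^esub> X" "Cod S (\<epsilon> X Y) = Y"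
  using counit_hom(1)[OF assms] by (auto simp: hom_iff)

text \<open>Yoneda: naturality in \<open>K\<close>, applied to the counit, gives
  \<open>\<phi> \<epsilon> \<cdot> u\<close>, and \<open>\<phi> \<epsilon>\<close> is the
  identity.\<close>

lemma \<phi>_counit:
  assumes "u \<in> hom V K (H\<^sub>o X Y)" "X \<in> Ob S" "Y \<in> Ob S"
  shows "\<phi> K X Y (\<epsilon> X Y \<cdot>\<^bsub>S\<^esub> (u \<odot>\<^sub>m\<^bsub>S\<^esub> \<one>\<^bsub>S\<^esub> X)) = u"
  using \<phi>_natural[of u K "H\<^sub>o X Y" "\<one>\<^bsub>S\<^esub> X" X X "\<one>\<^bsub>S\<^esub> Y" Y Y "\<epsilon> X Y"] assms
  by (simp add: counit_hom hom_iff)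

text \<open>Applying \<open>\<phi>\<close> to the transpose recovers the morphism. All equations
  between morphisms into \<open>H\<^sub>o X Y\<close> are proved below through this rule.\<close>

lemma counit_transpose_inj:
  assumes "u \<in> hom V K (H\<^sub>o X Y)" "v \<in> hom V K (H\<^sub>o X Y)" "X \<in> Ob S" "Y \<in> Ob S"
    and "\<epsilon> X Y \<cdot>\<^bsub>S\<^esub> (u \<odot>\<^sub>m\<^bsub>S\<^esub> \<one>\<^bsub>S\<^esub> X) = \<epsilon> X Y \<cdot>\<^bsub>S\<^esub> (v \<odot>\<^sub>m\<^bsub>S\<^esub> \<one>\<^bsub>S\<^esub> X)"
  shows "u = v"
  using assms \<phi>_counit by metis

text \<open>Both sides have the same image under the injective \<open>\<phi> K X Y\<close>. Together
  with \<open>\<phi>_counit\<close> this says that transposing is the two-sided inverse of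
  \<open>\<phi>\<close>.\<close>

lemma counit_transpose:
  assumes "K \<in> Ob V" "X \<in> Ob S" "Y \<in> Ob S" "h \<in> Mor S" "Dom S h = K \<odot>\<^bsub>S\<^esub> X" "Cod S h = Y"
  shows "\<epsilon> X Y \<cdot>\<^bsub>S\<^esub> (\<phi> K X Y h \<odot>\<^sub>m\<^bsub>S\<^esub> \<one>\<^bsub>S\<^esub> X) = h"
proof -
  have "\<phi> K X Y (\<epsilon> X Y \<cdot>\<^bsub>S\<^esub> (\<phi> K X Y h \<odot>\<^sub>m\<^bsub>S\<^esub> \<one>\<^bsub>S\<^esub> X)) = \<phi> K X Y h"
    using assms by (intro \<phi>_counit) (auto simp: hom_iff)
  moreover have "\<epsilon> X Y \<cdot>\<^bsub>S\<^esub> (\<phi> K X Y h \<odot>\<^sub>m\<^bsub>S\<^esub> \<one>\<^bsub>S\<^esub> X) \<in> hom S (K \<odot>\<^bsub>S\<^esub> X) Y" "h \<in> hom S (K \<odot>\<^bsub>S\<^esub> X) Y"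
    using assms by (auto simp: hom_iff)
  ultimately show ?thesis
    using \<phi>_bij[of K X Y] assms by (metis bij_betw_imp_inj_on inj_onD)
qed

text \<open>Naturality of \<open>\<phi>\<close> at the counit shows that
  \<open>H\<^sub>m f g\<close> is the image under \<open>\<phi>\<close> of the right side;
  transposing back gives the equation.\<close>

lemma counit_hom_mor:
  assumes "f \<in> hom S X' X" "g \<in> hom S Y Y'"
  shows "\<epsilon> X' Y' \<cdot>\<^bsub>S\<^esub> (H\<^sub>m f g \<odot>\<^sub>m\<^bsub>S\<^esub> \<one>\<^bsub>S\<^esub> X') = g \<cdot>\<^bsub>S\<^esub> \<epsilon> X Y \<cdot>\<^bsub>S\<^esub> (\<one>\<^bsub>V\<^esub> (H\<^sub>o X Y) \<odot>\<^sub>m\<^bsub>S\<^esub> f)"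
proof -
  have Ob: "X \<in> Ob S" "X' \<in> Ob S" "Y \<in> Ob S" "Y' \<in> Ob S" using assms by (auto simp: hom_iff)
  have "\<phi> (H\<^sub>o X Y) X' Y' (g \<cdot>\<^bsub>S\<^esub> \<epsilon> X Y \<cdot>\<^bsub>S\<^esub> (\<one>\<^bsub>V\<^esub> (H\<^sub>o X Y) \<odot>\<^sub>m\<^bsub>S\<^esub> f)) = H\<^sub>m f g"
    using \<phi>_natural[of "\<one>\<^bsub>V\<^esub> (H\<^sub>o X Y)" "H\<^sub>o X Y" "H\<^sub>o X Y" f X' X g Y Y' "\<epsilon> X Y"] assms Ob
    by (simp add: counit_hom hom_iff)
  then show ?thesis
    using counit_transpose[of "H\<^sub>o X Y" X' Y' "g \<cdot>\<^bsub>S\<^esub> \<epsilon> X Y \<cdot>\<^bsub>S\<^esub> (\<one>\<^bsub>V\<^esub> (H\<^sub>o X Y) \<odot>\<^sub>m\<^bsub>S\<^esub> f)"] assms Ob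
    by (simp add: hom_iff)
qed

section \<open>Composition, names of morphisms and the axioms\<close>

abbreviation bullet :: "'p \<Rightarrow> 'p \<Rightarrow> 'p \<Rightarrow> 'm" where
  "bullet X Y Z \<equiv> \<phi> (H\<^sub>o Y Z \<otimes>\<^bsub>V\<^esub> H\<^sub>o X Y) X Z
    (\<epsilon> Y Z \<cdot>\<^bsub>S\<^esub> (\<one>\<^bsub>V\<^esub> (H\<^sub>o Y Z) \<odot>\<^sub>m\<^bsub>S\<^esub> \<epsilon> X Y) \<cdot>\<^bsub>S\<^esub> act_assoc S (H\<^sub>o Y Z) (H\<^sub>o X Y) X)"

text \<open>The name of a morphism in the sense of enriched category theory: the point of the
  hom-object that represents it. An abbreviation leaves exactly the term that the final claim
  contains, so nothing has to be unfolded there.\<close>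

abbreviation name :: "'p \<Rightarrow> 'p \<Rightarrow> 'n \<Rightarrow> 'm" where
  "name X Y f \<equiv> \<phi> \<I>\<^bsub>V\<^esub> X Y (f \<cdot>\<^bsub>S\<^esub> act_lunit S X)"

text \<open>The transpose of the composition is
  \<open>\<epsilon> \<cdot> (1 \<odot> \<epsilon>) \<cdot> a\<close>; naturality of \<open>a\<close>
  moves \<open>u\<close> and \<open>v\<close> past it, and interchange merges them with the counits.
  The factor \<open>w\<close> makes room for the associator and the inverse unit isomorphisms of the
  axioms.\<close>

lemma counit_bullet:
  assumes "X \<in> Ob S" "Y \<in> Ob S" "Z \<in> Ob S" "u \<in> Mor V" "v \<in> Mor V" "w \<in> Mor V"
    and "Cod V u = H\<^sub>o Y Z" "Cod V v = H\<^sub>o X Y" "Cod V w = Dom V u \<otimes>\<^bsub>V\<^esub> Dom V v"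
  shows "\<epsilon> X Z \<cdot>\<^bsub>S\<^esub> ((bullet X Y Z \<cdot>\<^bsub>V\<^esub> (u \<otimes>\<^sub>m\<^bsub>V\<^esub> v) \<cdot>\<^bsub>V\<^esub> w) \<odot>\<^sub>m\<^bsub>S\<^esub> \<one>\<^bsub>S\<^esub> X)
    = \<epsilon> Y Z \<cdot>\<^bsub>S\<^esub> (u \<odot>\<^sub>m\<^bsub>S\<^esub> (\<epsilon> X Y \<cdot>\<^bsub>S\<^esub> (v \<odot>\<^sub>m\<^bsub>S\<^esub> \<one>\<^bsub>S\<^esub> X))) \<cdot>\<^bsub>S\<^esub> act_assoc S (Dom V u) (Dom V v) X \<cdot>\<^bsub>S\<^esub> (w \<odot>\<^sub>m\<^bsub>S\<^esub> \<one>\<^bsub>S\<^esub> X)"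
    (is "?l = ?r")
proof -
  have "?l = \<epsilon> X Z \<cdot>\<^bsub>S\<^esub> (bullet X Y Z \<odot>\<^sub>m\<^bsub>S\<^esub> \<one>\<^bsub>S\<^esub> X) \<cdot>\<^bsub>S\<^esub> ((u \<otimes>\<^sub>m\<^bsub>V\<^esub> v) \<odot>\<^sub>m\<^bsub>S\<^esub> \<one>\<^bsub>S\<^esub> X) \<cdot>\<^bsub>S\<^esub> (w \<odot>\<^sub>m\<^bsub>S\<^esub> \<one>\<^bsub>S\<^esub> X)"
    using assms by (simp add: act_Comp)
  \<comment> \<open>The bracket exposes the transpose of the composition, to be evaluated by
    \<open>counit_transpose\<close>.\<close>
  also have "\<dots> = (\<epsilon> X Z \<cdot>\<^bsub>S\<^esub> (bullet X Y Z \<odot>\<^sub>m\<^bsub>S\<^esub> \<one>\<^bsub>S\<^esub> X)) \<cdot>\<^bsub>S\<^esub> ((u \<otimes>\<^sub>m\<^bsub>V\<^esub> v) \<odot>\<^sub>m\<^bsub>S\<^esub> \<one>\<^bsub>S\<^esub> X) \<cdot>\<^bsub>S\<^esub> (w \<odot>\<^sub>m\<^bsub>S\<^esub> \<one>\<^bsub>S\<^esub> X)"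
    using assms by (intro S.Comp_assoc_Mor[symmetric]) auto
  also have "\<dots> = \<epsilon> Y Z \<cdot>\<^bsub>S\<^esub> (\<one>\<^bsub>V\<^esub> (H\<^sub>o Y Z) \<odot>\<^sub>m\<^bsub>S\<^esub> \<epsilon> X Y) \<cdot>\<^bsub>S\<^esub> act_assoc S (H\<^sub>o Y Z) (H\<^sub>o X Y) X
      \<cdot>\<^bsub>S\<^esub> ((u \<otimes>\<^sub>m\<^bsub>V\<^esub> v) \<odot>\<^sub>m\<^bsub>S\<^esub> \<one>\<^bsub>S\<^esub> X) \<cdot>\<^bsub>S\<^esub> (w \<odot>\<^sub>m\<^bsub>S\<^esub> \<one>\<^bsub>S\<^esub> X)"
    using assms by (simp add: counit_transpose)
  also have "\<dots> = ?r"
    using assms by (simp add: act_assoc_natural_Comp act_Comp_Comp)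
  finally show ?thesis .
qed

text \<open>Both transposes apply the three counits in succession, the innermost first. They differ
  only in the associativity isomorphisms in front, which the pentagon identifies.\<close>

lemma bullet_associative:
  assumes "X \<in> Ob S" "Y \<in> Ob S" "Z \<in> Ob S" "W \<in> Ob S"
  shows "bullet X Y W \<cdot>\<^bsub>V\<^esub> (bullet Y Z W \<otimes>\<^sub>m\<^bsub>V\<^esub> \<one>\<^bsub>V\<^esub> (H\<^sub>o X Y))
    = bullet X Z W \<cdot>\<^bsub>V\<^esub> (\<one>\<^bsub>V\<^esub> (H\<^sub>o Z W) \<otimes>\<^sub>m\<^bsub>V\<^esub> bullet X Y Z) \<cdot>\<^bsub>V\<^esub> assoc V (H\<^sub>o Z W) (H\<^sub>o Y Z) (H\<^sub>o X Y)"
    (is "?l = ?r")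
proof (rule counit_transpose_inj)
  let ?ZW = "H\<^sub>o Z W" and ?YZ = "H\<^sub>o Y Z" and ?XY = "H\<^sub>o X Y"
  show "?l \<in> hom V ((?ZW \<otimes>\<^bsub>V\<^esub> ?YZ) \<otimes>\<^bsub>V\<^esub> ?XY) (H\<^sub>o X W)" "?r \<in> hom V ((?ZW \<otimes>\<^bsub>V\<^esub> ?YZ) \<otimes>\<^bsub>V\<^esub> ?XY) (H\<^sub>o X W)"
    "X \<in> Ob S" "W \<in> Ob S"
    using assms by (simp_all add: hom_iff)
  \<comment> \<open>Here \<open>w\<close> is an identity, which simplification removes.\<close>
  have "\<epsilon> X W \<cdot>\<^bsub>S\<^esub> (?l \<odot>\<^sub>m\<^bsub>S\<^esub> \<one>\<^bsub>S\<^esub> X) = \<epsilon> Y W \<cdot>\<^bsub>S\<^esub> (bullet Y Z W \<odot>\<^sub>m\<^bsub>S\<^esub> \<epsilon> X Y) \<cdot>\<^bsub>S\<^esub> act_assoc S (?ZW \<otimes>\<^bsub>V\<^esub> ?YZ) ?XY X"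
    using counit_bullet[of X Y W "bullet Y Z W" "\<one>\<^bsub>V\<^esub> ?XY" "\<one>\<^bsub>V\<^esub> ((?ZW \<otimes>\<^bsub>V\<^esub> ?YZ) \<otimes>\<^bsub>V\<^esub> ?XY)"] assms by simp
  \<comment> \<open>Interchange separates the inner composition from the counit, so that it acts
    beside the identity of \<open>Y\<close> and can be transposed there.\<close>
  also have "bullet Y Z W \<odot>\<^sub>m\<^bsub>S\<^esub> \<epsilon> X Y = (bullet Y Z W \<odot>\<^sub>m\<^bsub>S\<^esub> \<one>\<^bsub>S\<^esub> Y) \<cdot>\<^bsub>S\<^esub> (\<one>\<^bsub>V\<^esub> (?ZW \<otimes>\<^bsub>V\<^esub> ?YZ) \<odot>\<^sub>m\<^bsub>S\<^esub> \<epsilon> X Y)"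
    using assms by (simp add: act_Comp)
  also have "\<epsilon> Y W \<cdot>\<^bsub>S\<^esub> (\<dots>) \<cdot>\<^bsub>S\<^esub> act_assoc S (?ZW \<otimes>\<^bsub>V\<^esub> ?YZ) ?XY X
      = (\<epsilon> Y W \<cdot>\<^bsub>S\<^esub> (bullet Y Z W \<odot>\<^sub>m\<^bsub>S\<^esub> \<one>\<^bsub>S\<^esub> Y)) \<cdot>\<^bsub>S\<^esub> (\<one>\<^bsub>V\<^esub> (?ZW \<otimes>\<^bsub>V\<^esub> ?YZ) \<odot>\<^sub>m\<^bsub>S\<^esub> \<epsilon> X Y) \<cdot>\<^bsub>S\<^esub> act_assoc S (?ZW \<otimes>\<^bsub>V\<^esub> ?YZ) ?XY X"
    using assms by simp
  also have "\<dots> = \<epsilon> Z W \<cdot>\<^bsub>S\<^esub> (\<one>\<^bsub>V\<^esub> ?ZW \<odot>\<^sub>m\<^bsub>S\<^esub> \<epsilon> Y Z) \<cdot>\<^bsub>S\<^esub> act_assoc S ?ZW ?YZ Y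
      \<cdot>\<^bsub>S\<^esub> (\<one>\<^bsub>V\<^esub> (?ZW \<otimes>\<^bsub>V\<^esub> ?YZ) \<odot>\<^sub>m\<^bsub>S\<^esub> \<epsilon> X Y) \<cdot>\<^bsub>S\<^esub> act_assoc S (?ZW \<otimes>\<^bsub>V\<^esub> ?YZ) ?XY X"
    using assms by (simp add: counit_transpose)
  \<comment> \<open>Naturality of the associativity at \<open>\<epsilon> X Y\<close>, where the
    identity of the tensor product counts as a tensor product of identities.\<close>
  also have "\<dots> = \<epsilon> Z W \<cdot>\<^bsub>S\<^esub> (\<one>\<^bsub>V\<^esub> ?ZW \<odot>\<^sub>m\<^bsub>S\<^esub> (\<epsilon> Y Z \<cdot>\<^bsub>S\<^esub> (\<one>\<^bsub>V\<^esub> ?YZ \<odot>\<^sub>m\<^bsub>S\<^esub> \<epsilon> X Y)))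
      \<cdot>\<^bsub>S\<^esub> act_assoc S ?ZW ?YZ (?XY \<odot>\<^bsub>S\<^esub> X) \<cdot>\<^bsub>S\<^esub> act_assoc S (?ZW \<otimes>\<^bsub>V\<^esub> ?YZ) ?XY X"
    using assms act_assoc_natural_Comp[of "\<one>\<^bsub>V\<^esub> ?ZW" "\<one>\<^bsub>V\<^esub> ?YZ" "\<epsilon> X Y" ?ZW ?YZ Y
        "act_assoc S (?ZW \<otimes>\<^bsub>V\<^esub> ?YZ) ?XY X"]
    by (simp add: V.tensor_Id act_Comp_Comp)
  also have "\<dots> = \<epsilon> Z W \<cdot>\<^bsub>S\<^esub> (\<one>\<^bsub>V\<^esub> ?ZW \<odot>\<^sub>m\<^bsub>S\<^esub> (\<epsilon> Y Z \<cdot>\<^bsub>S\<^esub> (\<one>\<^bsub>V\<^esub> ?YZ \<odot>\<^sub>m\<^bsub>S\<^esub> \<epsilon> X Y)))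
      \<cdot>\<^bsub>S\<^esub> (\<one>\<^bsub>V\<^esub> ?ZW \<odot>\<^sub>m\<^bsub>S\<^esub> act_assoc S ?YZ ?XY X) \<cdot>\<^bsub>S\<^esub> act_assoc S ?ZW (?YZ \<otimes>\<^bsub>V\<^esub> ?XY) X
      \<cdot>\<^bsub>S\<^esub> (assoc V ?ZW ?YZ ?XY \<odot>\<^sub>m\<^bsub>S\<^esub> \<one>\<^bsub>S\<^esub> X)"
    using assms by (simp add: act_pentagon)
  \<comment> \<open>The rule \<open>counit_bullet\<close> read backwards, with the associator as
    \<open>w\<close>; the factor \<open>\<epsilon> \<cdot> (1 \<odot> \<epsilon>) \<cdot> a\<close>
    under the action of \<open>H\<^sub>o Z W\<close> is the transpose of
    \<open>bullet X Y Z\<close>.\<close>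
  also have "\<dots> = \<epsilon> X W \<cdot>\<^bsub>S\<^esub> (?r \<odot>\<^sub>m\<^bsub>S\<^esub> \<one>\<^bsub>S\<^esub> X)"
    using assms counit_bullet[of X Z W "\<one>\<^bsub>V\<^esub> ?ZW" "bullet X Y Z" "assoc V ?ZW ?YZ ?XY"]
    by (simp add: counit_transpose act_Comp_Comp)
  finally show "\<epsilon> X W \<cdot>\<^bsub>S\<^esub> (?l \<odot>\<^sub>m\<^bsub>S\<^esub> \<one>\<^bsub>S\<^esub> X) = \<epsilon> X W \<cdot>\<^bsub>S\<^esub> (?r \<odot>\<^sub>m\<^bsub>S\<^esub> \<one>\<^bsub>S\<^esub> X)" .
qed

text \<open>The right side transposes to
  \<open>\<epsilon> \<cdot> (1 \<odot> (f \<cdot> l)) \<cdot> a\<close> after the inverse of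
  \<open>r\<close>. The triangle turns \<open>(1 \<odot> l) \<cdot> a\<close> into
  \<open>r \<odot> 1\<close>, which cancels, and the transpose of \<open>H\<^sub>m f 1\<close>
  remains.\<close>

lemma bullet_name_right:
  assumes f: "f \<in> hom S X Y" and Z: "Z \<in> Ob S"
  shows "H\<^sub>m f (\<one>\<^bsub>S\<^esub> Z) = bullet X Y Z \<cdot>\<^bsub>V\<^esub> (\<one>\<^bsub>V\<^esub> (H\<^sub>o Y Z) \<otimes>\<^sub>m\<^bsub>V\<^esub> name X Y f)
    \<cdot>\<^bsub>V\<^esub> inverse_mor V (runit V (H\<^sub>o Y Z))" (is "?l = ?r")
proof (rule counit_transpose_inj)
  have X: "X \<in> Ob S" and Y: "Y \<in> Ob S" using f by (auto simp: hom_iff)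
  have YZ: "H\<^sub>o Y Z \<in> Ob V" using Y Z by simp
  let ?r' = "inverse_mor V (runit V (H\<^sub>o Y Z))"
  note inv [simp] = V.inverse_mor[OF V.runit_iso[OF YZ]]
  note f' = f[unfolded hom_iff]
  show "?l \<in> hom V (H\<^sub>o Y Z) (H\<^sub>o X Z)" "?r \<in> hom V (H\<^sub>o Y Z) (H\<^sub>o X Z)" "X \<in> Ob S" "Z \<in> Ob S"
    using f' X Y Z by (auto simp: hom_iff)
  have "\<epsilon> X Z \<cdot>\<^bsub>S\<^esub> (?r \<odot>\<^sub>m\<^bsub>S\<^esub> \<one>\<^bsub>S\<^esub> X) = \<epsilon> Y Z \<cdot>\<^bsub>S\<^esub> (\<one>\<^bsub>V\<^esub> (H\<^sub>o Y Z) \<odot>\<^sub>m\<^bsub>S\<^esub> (f \<cdot>\<^bsub>S\<^esub> act_lunit S X))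
      \<cdot>\<^bsub>S\<^esub> act_assoc S (H\<^sub>o Y Z) \<I>\<^bsub>V\<^esub> X \<cdot>\<^bsub>S\<^esub> (?r' \<odot>\<^sub>m\<^bsub>S\<^esub> \<one>\<^bsub>S\<^esub> X)"
    using counit_bullet[of X Y Z "\<one>\<^bsub>V\<^esub> (H\<^sub>o Y Z)" "name X Y f" ?r'] f' X Y Z
    by (simp add: counit_transpose)
  also have "\<dots> = \<epsilon> Y Z \<cdot>\<^bsub>S\<^esub> (\<one>\<^bsub>V\<^esub> (H\<^sub>o Y Z) \<odot>\<^sub>m\<^bsub>S\<^esub> f) \<cdot>\<^bsub>S\<^esub> ((\<one>\<^bsub>V\<^esub> (H\<^sub>o Y Z) \<odot>\<^sub>m\<^bsub>S\<^esub> act_lunit S X)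
      \<cdot>\<^bsub>S\<^esub> act_assoc S (H\<^sub>o Y Z) \<I>\<^bsub>V\<^esub> X) \<cdot>\<^bsub>S\<^esub> (?r' \<odot>\<^sub>m\<^bsub>S\<^esub> \<one>\<^bsub>S\<^esub> X)"
    using f' X Y Z by (simp add: act_Comp_Comp)
  \<comment> \<open>The triangle is applied with \<open>simp only\<close> first, since full
    simplification would reassociate the bracket it has to match.\<close>
  also have "\<dots> = \<epsilon> Y Z \<cdot>\<^bsub>S\<^esub> (\<one>\<^bsub>V\<^esub> (H\<^sub>o Y Z) \<odot>\<^sub>m\<^bsub>S\<^esub> f)"
    using f' X Y Z by (simp only: act_triangle YZ) (simp add: act_Comp)
  also have "\<dots> = \<epsilon> X Z \<cdot>\<^bsub>S\<^esub> (?l \<odot>\<^sub>m\<^bsub>S\<^esub> \<one>\<^bsub>S\<^esub> X)"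
    using counit_hom_mor[OF f, of "\<one>\<^bsub>S\<^esub> Z" Z Z] f' X Y Z by (simp add: hom_iff)
  finally show "\<epsilon> X Z \<cdot>\<^bsub>S\<^esub> (?l \<odot>\<^sub>m\<^bsub>S\<^esub> \<one>\<^bsub>S\<^esub> X) = \<epsilon> X Z \<cdot>\<^bsub>S\<^esub> (?r \<odot>\<^sub>m\<^bsub>S\<^esub> \<one>\<^bsub>S\<^esub> X)" by simp
qed

text \<open>Transposing the name of \<open>g\<close> produces \<open>g \<cdot> l\<close>; naturality
  moves \<open>l\<close> past the counit, where the left unit triangle makes it cancel with the
  inverse unit isomorphism.\<close>

lemma bullet_name_left:
  assumes g: "g \<in> hom S Y Z" and X: "X \<in> Ob S"
  shows "H\<^sub>m (\<one>\<^bsub>S\<^esub> X) g = bullet X Y Z \<cdot>\<^bsub>V\<^esub> (name Y Z g \<otimes>\<^sub>m\<^bsub>V\<^esub> \<one>\<^bsub>V\<^esub> (H\<^sub>o X Y))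
    \<cdot>\<^bsub>V\<^esub> inverse_mor V (lunit V (H\<^sub>o X Y))" (is "?l = ?r")
proof (rule counit_transpose_inj)
  have Y: "Y \<in> Ob S" and Z: "Z \<in> Ob S" using g by (auto simp: hom_iff)
  have XY: "H\<^sub>o X Y \<in> Ob V" using X Y by simp
  let ?l' = "inverse_mor V (lunit V (H\<^sub>o X Y))"
  let ?A = "act_assoc S \<I>\<^bsub>V\<^esub> (H\<^sub>o X Y) X"
  note inv [simp] = V.inverse_mor[OF V.lunit_iso[OF XY]]
  note g' = g[unfolded hom_iff]
  show "?l \<in> hom V (H\<^sub>o X Y) (H\<^sub>o X Z)" "?r \<in> hom V (H\<^sub>o X Y) (H\<^sub>o X Z)" "X \<in> Ob S" "Z \<in> Ob S"
    using g' X Y Z by (auto simp: hom_iff)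
  have "\<epsilon> X Z \<cdot>\<^bsub>S\<^esub> (?r \<odot>\<^sub>m\<^bsub>S\<^esub> \<one>\<^bsub>S\<^esub> X) = \<epsilon> Y Z \<cdot>\<^bsub>S\<^esub> (name Y Z g \<odot>\<^sub>m\<^bsub>S\<^esub> \<epsilon> X Y) \<cdot>\<^bsub>S\<^esub> ?A \<cdot>\<^bsub>S\<^esub> (?l' \<odot>\<^sub>m\<^bsub>S\<^esub> \<one>\<^bsub>S\<^esub> X)"
    using counit_bullet[of X Y Z "name Y Z g" "\<one>\<^bsub>V\<^esub> (H\<^sub>o X Y)" ?l'] g' X Y Z by simp
  \<comment> \<open>As for associativity, the name is separated from the counit so that it can be
    transposed at \<open>Y\<close>.\<close>
  also have "name Y Z g \<odot>\<^sub>m\<^bsub>S\<^esub> \<epsilon> X Y = (name Y Z g \<odot>\<^sub>m\<^bsub>S\<^esub> \<one>\<^bsub>S\<^esub> Y) \<cdot>\<^bsub>S\<^esub> (\<one>\<^bsub>V\<^esub> \<I>\<^bsub>V\<^esub> \<odot>\<^sub>m\<^bsub>S\<^esub> \<epsilon> X Y)"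
    using g' X Y Z by (simp add: act_Comp)
  also have "\<epsilon> Y Z \<cdot>\<^bsub>S\<^esub> (\<dots>) \<cdot>\<^bsub>S\<^esub> ?A \<cdot>\<^bsub>S\<^esub> (?l' \<odot>\<^sub>m\<^bsub>S\<^esub> \<one>\<^bsub>S\<^esub> X)
      = (\<epsilon> Y Z \<cdot>\<^bsub>S\<^esub> (name Y Z g \<odot>\<^sub>m\<^bsub>S\<^esub> \<one>\<^bsub>S\<^esub> Y)) \<cdot>\<^bsub>S\<^esub> (\<one>\<^bsub>V\<^esub> \<I>\<^bsub>V\<^esub> \<odot>\<^sub>m\<^bsub>S\<^esub> \<epsilon> X Y) \<cdot>\<^bsub>S\<^esub> ?A \<cdot>\<^bsub>S\<^esub> (?l' \<odot>\<^sub>m\<^bsub>S\<^esub> \<one>\<^bsub>S\<^esub> X)"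
    using g' X Y Z by simp
  also have "\<dots> = g \<cdot>\<^bsub>S\<^esub> (act_lunit S Y \<cdot>\<^bsub>S\<^esub> (\<one>\<^bsub>V\<^esub> \<I>\<^bsub>V\<^esub> \<odot>\<^sub>m\<^bsub>S\<^esub> \<epsilon> X Y)) \<cdot>\<^bsub>S\<^esub> ?A \<cdot>\<^bsub>S\<^esub> (?l' \<odot>\<^sub>m\<^bsub>S\<^esub> \<one>\<^bsub>S\<^esub> X)"
    using g' X Y Z by (simp add: counit_transpose)
  \<comment> \<open>Naturality of \<open>l\<close> at \<open>\<epsilon> X Y\<close> creates the left
    side of the left unit triangle.\<close>
  also have "\<dots> = g \<cdot>\<^bsub>S\<^esub> \<epsilon> X Y \<cdot>\<^bsub>S\<^esub> (act_lunit S (H\<^sub>o X Y \<odot>\<^bsub>S\<^esub> X) \<cdot>\<^bsub>S\<^esub> ?A) \<cdot>\<^bsub>S\<^esub> (?l' \<odot>\<^sub>m\<^bsub>S\<^esub> \<one>\<^bsub>S\<^esub> X)"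
    using g' X Y Z by (simp add: act_lunit_natural_Mor)
  also have "\<dots> = g \<cdot>\<^bsub>S\<^esub> \<epsilon> X Y"
    using g' X Y Z by (simp only: act_left_triangle XY) (simp add: act_Comp)
  also have "\<dots> = \<epsilon> X Z \<cdot>\<^bsub>S\<^esub> (?l \<odot>\<^sub>m\<^bsub>S\<^esub> \<one>\<^bsub>S\<^esub> X)"
    using counit_hom_mor[OF _ g, of "\<one>\<^bsub>S\<^esub> X" X X] g' X Y Z by (simp add: hom_iff)
  finally show "\<epsilon> X Z \<cdot>\<^bsub>S\<^esub> (?l \<odot>\<^sub>m\<^bsub>S\<^esub> \<one>\<^bsub>S\<^esub> X) = \<epsilon> X Z \<cdot>\<^bsub>S\<^esub> (?r \<odot>\<^sub>m\<^bsub>S\<^esub> \<one>\<^bsub>S\<^esub> X)" by simp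
qed

text \<open>A composite of two bijections: precomposition with the isomorphism \<open>l\<close>,
  undone by precomposition with its inverse, and \<open>\<phi>\<close> at the unit.\<close>

lemma name_bij:
  assumes X: "X \<in> Ob S" and Y: "Y \<in> Ob S"
  shows "bij_betw (name X Y) (hom S X Y) (hom V \<I>\<^bsub>V\<^esub> (H\<^sub>o X Y))"
proof -
  note inv [simp] = S.inverse_mor[OF act_lunit_iso[OF X]]
  have "bij_betw (\<lambda>f. f \<cdot>\<^bsub>S\<^esub> act_lunit S X) (hom S X Y) (hom S (\<I>\<^bsub>V\<^esub> \<odot>\<^bsub>S\<^esub> X) Y)"
    by (rule bij_betw_byWitness[where f' = "\<lambda>h. h \<cdot>\<^bsub>S\<^esub> inverse_mor S (act_lunit S X)"])
      (use X in \<open>auto simp: hom_iff\<close>)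
  then show ?thesis
    using bij_betw_trans[OF _ \<phi>_bij[OF V.unit_in_Ob X Y]] by (simp add: comp_def)
qed

text \<open>Naturality of \<open>l\<close> turns precomposition with \<open>f\<close> into
  precomposition with the action of the unit on \<open>f\<close>; then naturality of
  \<open>\<phi>\<close> applies with the identity of the unit in the first argument.\<close>

lemma name_natural:
  assumes "f \<in> hom S X' X" "g \<in> hom S Y Y'" "h \<in> hom S X Y"
  shows "name X' Y' (g \<cdot>\<^bsub>S\<^esub> h \<cdot>\<^bsub>S\<^esub> f) = H\<^sub>m f g \<cdot>\<^bsub>V\<^esub> name X Y h"
proof -
  have Ob: "X \<in> Ob S" "X' \<in> Ob S" "Y \<in> Ob S" using assms by (auto simp: hom_iff)
  have "(g \<cdot>\<^bsub>S\<^esub> h \<cdot>\<^bsub>S\<^esub> f) \<cdot>\<^bsub>S\<^esub> act_lunit S X' = g \<cdot>\<^bsub>S\<^esub> (h \<cdot>\<^bsub>S\<^esub> act_lunit S X) \<cdot>\<^bsub>S\<^esub> (\<one>\<^bsub>V\<^esub> \<I>\<^bsub>V\<^esub> \<odot>\<^sub>m\<^bsub>S\<^esub> f)"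
    using assms Ob by (simp add: hom_iff act_lunit_natural_Mor)
  then show ?thesis
    using \<phi>_natural[of "\<one>\<^bsub>V\<^esub> \<I>\<^bsub>V\<^esub>" "\<I>\<^bsub>V\<^esub>" "\<I>\<^bsub>V\<^esub>" f X' X g Y Y' "h \<cdot>\<^bsub>S\<^esub> act_lunit S X"] assms Ob
    by (simp add: hom_iff)
qed

end

theorem proposition1p18:
  fixes V :: "('o, 'm) monoidal_cat"
    and S :: "('p, 'n, 'o, 'm) module_cat"
    and H\<^sub>o :: "'p \<Rightarrow> 'p \<Rightarrow> 'o" and H\<^sub>m :: "'n \<Rightarrow> 'n \<Rightarrow> 'm"
    and \<phi> :: "'o \<Rightarrow> 'p \<Rightarrow> 'p \<Rightarrow> 'n \<Rightarrow> 'm"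
  assumes "tensor_closed_module V S H\<^sub>o H\<^sub>m \<phi>"
  shows "V_structure V S H\<^sub>o H\<^sub>m
    (\<lambda>X Y Z. \<phi> (H\<^sub>o Y Z \<otimes>\<^bsub>V\<^esub> H\<^sub>o X Y) X Z
      (counit V S H\<^sub>o \<phi> Y Z
        \<cdot>\<^bsub>S\<^esub> (\<one>\<^bsub>V\<^esub> (H\<^sub>o Y Z) \<odot>\<^sub>m\<^bsub>S\<^esub> counit V S H\<^sub>o \<phi> X Y)
        \<cdot>\<^bsub>S\<^esub> act_assoc S (H\<^sub>o Y Z) (H\<^sub>o X Y) X))
    (\<lambda>X Y f. \<phi> \<I>\<^bsub>V\<^esub> X Y (f \<cdot>\<^bsub>S\<^esub> act_lunit S X))"
proof -
  interpret tensor_closed_module V S H\<^sub>o H\<^sub>m \<phi> by (rule assms)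
  show ?thesis
    \<comment> \<open>The typing of the composition has no lemma of its own; it and the side
      conditions on objects are left to the typing rules.\<close>
    by (intro V_structure.intro V_structure_axioms.intro V.monoidal_category_axioms
        S.category_axioms hom_functor bullet_associative bullet_name_right bullet_name_left
        name_bij name_natural)
      (simp_all add: hom_iff)
qed

end
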